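(* Let $\mathfrak g=\mathfrak{sl}(5,\mathbb R)$ with the grading corresponding to the flag variety $F_{2,4}(\mathbb R^5)$, let $\mathfrak p=\mathfrak g_0+\mathfrak g_1+\mathfrak g_2$, and let $x=E_{31}+E_{42}+E_{54}\in\mathfrak g_{-1}$. Let $\mathfrak s=\sum_{i\ge-1}\mathfrak s_i$ be the symmetry algebra of the flat curve of type $x$ and $\mathfrak s^{(0)}=\sum_{i\ge0}\mathfrak s_i$. Then there is no $\mathfrak s^{(0)}$-invariant subspace $W\subset\mathfrak p$ complementary in $\mathfrak p$ to $\mathfrak s^{(0)}+[x,\mathfrak g_1+\mathfrak g_2]$.
   Context: $E_{ij}$ denotes the $5\times5$ matrix unit. The grading of $\mathfrak{sl}(5,\mathbb R)$ is defined by the block decomposition of sizes $2,2,1$: $E_{ij}$ with $i$ in block $a$ and $j$ in block $b$ has degree $b-a$ (blocks $\{1,2\},\{3,4\},\{5\}$ numbered $1,2,3$), and diagonal matrices have degree $0$. So $\mathfrak g=\sum_{i=-2}^2\mathfrak g_i$. The symmetry algebra $\mathfrak s$ of the flat curve (the closure of the orbit of $\exp(tx)$ through the base point of $F_{2,4}(\mathbb R^5)=SL(5,\mathbb R)/P$) is the graded subalgebra with $\mathfrak s_i=0$ for $i\le-2$, $\mathfrak s_{-1}=\langle x\rangle$, and $\mathfrak s_i=\{u\in\mathfrak g_i:[x,u]\in\mathfrak s_{i-1}\}$ for $i\ge0$. $\mathfrak s^{(0)}$-invariant means $[\mathfrak s^{(0)},W]\subset W$. *)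

theory Defs
  imports "HOL-Analysis.Analysis"
begin

(* Indices 1, ..., 5 live in the numeral type 5 of integers modulo 5, so the
   fifth index is (5::5) = 0. *)

type_synonym mat5 = "real^5^5"

definition mat_unit :: "5 \<Rightarrow> 5 \<Rightarrow> mat5" where
  "mat_unit i j = (\<chi> a b. if a = i \<and> b = j then 1 else 0)"

definition bracket :: "mat5 \<Rightarrow> mat5 \<Rightarrow> mat5" where
  "bracket A B = A ** B - B ** A"

definition sl5 :: "mat5 set" where
  "sl5 = {A. trace A = 0}"

definition block :: "5 \<Rightarrow> int" where
  "block i = (if i \<in> {1, 2} then 1 else if i \<in> {3, 4} then 2 else 3)"

definition grade :: "int \<Rightarrow> mat5 set" where
  "grade k = sl5 \<inter> span {mat_unit i j | i j. block j - block i = k}"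

(* Sums of subspaces are the library's elementwise sums of sets. *)
definition parabolic :: "mat5 set" where
  "parabolic = grade 0 + grade 1 + grade 2"

function sym_comp :: "mat5 \<Rightarrow> int \<Rightarrow> mat5 set" where
  "sym_comp x k =
     (if k \<le> -2 then {0}
      else if k = -1 then span {x}
      else {u \<in> grade k. bracket x u \<in> sym_comp x (k - 1)})"
  by auto
termination
  by (relation "Wellfounded.measure (\<lambda>(x, k). nat (k + 2))") auto

(* The recursive equation loops as a rewrite rule. *)
declare sym_comp.simps [simp del]

(* The sum of the components of degree at least k; sym_filt x (-1) is the
   whole symmetry algebra of the flat curve of type x. *)
definition sym_filt :: "mat5 \<Rightarrow> int \<Rightarrow> mat5 set" where
  "sym_filt x k = span (\<Union>i\<in>{k..}. sym_comp x i)"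

definition invariant_under :: "mat5 set \<Rightarrow> mat5 set \<Rightarrow> bool" where
  "invariant_under S W \<longleftrightarrow> (\<forall>u\<in>S. \<forall>w\<in>W. bracket u w \<in> W)"

definition complementary_in :: "mat5 set \<Rightarrow> mat5 set \<Rightarrow> mat5 set \<Rightarrow> bool" where
  "complementary_in U V W \<longleftrightarrow> V \<inter> W = {0} \<and> V + W = U"

end

theory Submission
  imports Defs
begin

text \<open>
  Put N = E12 + E34, an element of degree 0 commuting with x. Since N N = 0, ad N squared maps
  w to -2 N w N, which for w in p is a combination of E12, E14 and E34 in which E14 has the
  coefficient -2 w23. All three matrix units lie in V = s(0) + [x, g1 + g2], so ad N squared
  kills every invariant complement W, and W has no element with nonzero (2,3) entry. Neither has
  V, so E23 does not lie in V + W.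
\<close>

lemma UNIV_5: "(UNIV :: 5 set) = {1, 2, 3, 4, 5}"
proof -
  have "a \<in> {1, 2, 3, 4, 5}" for a :: 5
  proof (cases a)
    case (of_int z)
    then have "z = 0 \<or> z = 1 \<or> z = 2 \<or> z = 3 \<or> z = 4" by auto
    then show ?thesis using of_int by auto
  qed
  then show ?thesis by blast
qed

lemma sum_5: "sum f (UNIV :: 5 set) = f 1 + f 2 + f 3 + f 4 + f 5"
  for f :: "5 \<Rightarrow> 'a::comm_monoid_add"
  unfolding UNIV_5 by (simp add: add.assoc)

lemma forall_5: "(\<forall>i::5. P i) \<longleftrightarrow> P 1 \<and> P 2 \<and> P 3 \<and> P 4 \<and> P 5"
  using UNIV_5 by (metis UNIV_I empty_iff insert_iff)

lemma mat_unit_nth: "mat_unit i j $ a $ b = (if a = i \<and> b = j then 1 else 0)"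
  by (simp add: mat_unit_def)

lemma bracket_nth: "bracket A B $ i $ j = (\<Sum>k\<in>UNIV. A$i$k * B$k$j) - (\<Sum>k\<in>UNIV. B$i$k * A$k$j)"
  by (simp add: bracket_def matrix_matrix_mult_def)

text \<open>Turns an identity between explicit 5x5 matrices into 25 scalar equations.\<close>

lemmas entrywise = vec_eq_iff forall_5 bracket_nth mat_unit_nth sum_5

lemma grade_nth_eq_0:
  assumes "u \<in> grade k" "block j - block i \<noteq> k"
  shows "u $ i $ j = 0"
proof -
  have "u \<in> span {mat_unit i j | i j. block j - block i = k}"
    using assms(1) by (simp add: grade_def)
  then show ?thesis
    by (induction rule: span_induct)
      (use assms(2) in \<open>auto simp: mat_unit_nth subspace_def\<close>)
qed

lemma subspace_grade: "subspace (grade k)"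
proof -
  have "subspace sl5"
    by (auto simp: subspace_def sl5_def trace_def sum.distrib simp flip: sum_distrib_left)
  then show ?thesis
    unfolding grade_def by (intro subspace_inter subspace_span)
qed

lemma mat_unit_in_grade:
  assumes "i \<noteq> j" "block j - block i = k"
  shows "mat_unit i j \<in> grade k"
proof -
  have "mat_unit i j $ a $ a = 0" for a
    using assms(1) by (auto simp: mat_unit_nth)
  then show ?thesis
    using assms(2) by (auto simp: grade_def sl5_def trace_def intro!: span_base)
qed

lemma parabolic_nth_eq_0:
  assumes "w \<in> parabolic" "block j - block i < 0"
  shows "w $ i $ j = 0"
  using assms by (auto simp: parabolic_def set_plus_def grade_nth_eq_0)

lemma sym_comp_subset_grade: "k \<ge> 0 \<Longrightarrow> sym_comp x k \<subseteq> grade k"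
  by (subst sym_comp.simps) auto

lemma sym_comp_iff:
  "k \<ge> 0 \<Longrightarrow> u \<in> sym_comp x k \<longleftrightarrow> u \<in> grade k \<and> bracket x u \<in> sym_comp x (k - 1)"
  by (subst sym_comp.simps) simp

lemma sym_comp_minus_one: "sym_comp x (-1) = span {x}"
  by (subst sym_comp.simps) simp

lemma sym_comp_subset_sym_filt: "k \<le> i \<Longrightarrow> sym_comp x i \<subseteq> sym_filt x k"
  unfolding sym_filt_def by (auto intro!: span_base)

context
  fixes x :: mat5
  assumes x_def: "x = mat_unit 3 1 + mat_unit 4 2 + mat_unit 5 4"
begin

text \<open>Since E23 has degree 1, only \<open>k = 1\<close> needs an argument. There
  \<open>u\<close> satisfies [x, [x, u]] = c x for some scalar c.\<close>

lemma sym_comp_nth_2_3: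
  assumes "k \<ge> 0" "u \<in> sym_comp x k"
  shows "u $ 2 $ 3 = 0"
proof (cases "k = 1")
  case True
  with assms have "bracket x (bracket x u) \<in> span {x}"
    by (simp add: sym_comp_iff sym_comp_minus_one)
  then obtain c where "bracket x (bracket x u) = c *\<^sub>R x"
    by (auto simp: span_singleton)
  \<comment> \<open>The left-hand entry is \<open>u $ 2 $ 3\<close>: in x x u - 2 x u x + u x x only
    the first term contributes, because x x = E52 and column 3 of x is zero. The right-hand entry is
    0.\<close>
  then have "bracket x (bracket x u) $ 5 $ 3 = c * x $ 5 $ 3"
    by simp
  then show ?thesis
    by (simp add: x_def bracket_nth mat_unit_nth sum_5)
next
  case False
  then show ?thesis
    using assms sym_comp_subset_grade[of k x]
    by (intro grade_nth_eq_0[of _ k]) (auto simp: block_def)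
qed

lemma sym_filt_nth_2_3:
  assumes "u \<in> sym_filt x 0"
  shows "u $ 2 $ 3 = 0"
  using assms unfolding sym_filt_def
  by (induction rule: span_induct) (auto simp: subspace_def sym_comp_nth_2_3)

text \<open>Row 2 and column 3 of x are zero, so x u and u x both vanish at (2,3).\<close>

lemma bracket_nth_2_3: "bracket x u $ 2 $ 3 = 0"
  by (simp add: x_def bracket_nth mat_unit_nth sum_5)

text \<open>Both x N and N x equal E32 for N = E12 + E34, so the bracket is 0.\<close>

lemma N_in_sym_comp: "c *\<^sub>R (mat_unit 1 2 + mat_unit 3 4) \<in> sym_comp x 0"
proof -
  have "bracket x (c *\<^sub>R (mat_unit 1 2 + mat_unit 3 4)) = 0"
    by (simp add: x_def entrywise)
  then show ?thesis
    by (auto simp: sym_comp_iff sym_comp_minus_one span_zero block_def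
        intro!: subspace_add subspace_scale subspace_grade mat_unit_in_grade)
qed

text \<open>Bracketing with x sends E14 to E34 - E12 and E35 to -E34; the coefficient 2 makes the
  image of the combination equal to -N.\<close>

lemma M_in_sym_comp: "c *\<^sub>R (mat_unit 1 4 + 2 *\<^sub>R mat_unit 3 5) \<in> sym_comp x 1"
proof -
  have "bracket x (c *\<^sub>R (mat_unit 1 4 + 2 *\<^sub>R mat_unit 3 5))
      = (- c) *\<^sub>R (mat_unit 1 2 + mat_unit 3 4)"
    by (simp add: x_def entrywise)
  then show ?thesis
    using N_in_sym_comp[of "- c"]
    by (auto simp: sym_comp_iff[of 1] block_def
        intro!: subspace_add subspace_scale subspace_grade mat_unit_in_grade)
qed

lemma E12_E34_E14_in_sum:
  "a *\<^sub>R mat_unit 1 2 + b *\<^sub>R mat_unit 3 4 + c *\<^sub>R mat_unit 1 4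
     \<in> sym_filt x 0 + bracket x ` (grade 1 + grade 2)" (is "?z \<in> _")
proof -
  \<comment> \<open>The brackets of x with E14, E35 and E15 are E34 - E12, -E34 and E35 - E14. The
    first two give E12 and E34. With M = E14 + 2 E35, the third gives E14 = M/3 - (2/3) [x, E15],
    whence the thirds.\<close>
  let ?m = "(c / 3) *\<^sub>R (mat_unit 1 4 + 2 *\<^sub>R mat_unit 3 5)"
  let ?u = "((- a) *\<^sub>R mat_unit 1 4 + (- a - b) *\<^sub>R mat_unit 3 5) + (- 2 * c / 3) *\<^sub>R mat_unit 1 5"
  have "?m \<in> sym_filt x 0"
    using M_in_sym_comp sym_comp_subset_sym_filt[of 0 1 x] by auto
  moreover have "?u \<in> grade 1 + grade 2"
    by (intro set_plus_intro subspace_add subspace_scale subspace_grade mat_unit_in_grade)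
      (simp_all add: block_def)
  moreover have "?z = ?m + bracket x ?u"
    by (simp add: x_def entrywise)
  ultimately show ?thesis
    by (metis set_plus_intro imageI)
qed

end

lemma double_bracket_N:
  assumes "w \<in> parabolic" and N: "N = mat_unit 1 2 + mat_unit 3 4"
  shows "bracket N (bracket N w) =
    (- 2 * w$2$1) *\<^sub>R mat_unit 1 2 + (- 2 * w$4$3) *\<^sub>R mat_unit 3 4 + (- 2 * w$2$3) *\<^sub>R mat_unit 1 4"
proof -
  \<comment> \<open>The double bracket is -2 N w N, whose E32 coefficient is -2
    \<open>w $ 4 $ 1\<close>; it has to vanish for the three listed terms to suffice.\<close>
  have "w $ 4 $ 1 = 0"
    using assms(1) by (rule parabolic_nth_eq_0) (simp add: block_def)
  then show ?thesis
    by (simp add: N entrywise)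
qed

theorem mainTheorem4:
  fixes x :: mat5
  assumes x_def: "x = mat_unit 3 1 + mat_unit 4 2 + mat_unit 5 4"
  shows "\<not> (\<exists>W. subspace W \<and> W \<subseteq> parabolic \<and>
              invariant_under (sym_filt x 0) W \<and>
              complementary_in parabolic
                (sym_filt x 0 + bracket x ` (grade 1 + grade 2)) W)"
proof (intro notI, elim exE conjE)
  fix W
  let ?V = "sym_filt x 0 + bracket x ` (grade 1 + grade 2)"
  assume W: "subspace W" "W \<subseteq> parabolic" "invariant_under (sym_filt x 0) W"
    and compl: "complementary_in parabolic ?V W"
  define N :: mat5 where "N = mat_unit 1 2 + mat_unit 3 4"
  have "mat_unit 2 3 \<in> parabolic"
  proof -
    \<comment> \<open>E23 has degree 1, so the summands of degrees 0 and 2 are zero.\<close>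
    have "0 + mat_unit 2 3 + 0 \<in> parabolic"
      unfolding parabolic_def
      by (intro set_plus_intro subspace_0 subspace_grade mat_unit_in_grade) (simp_all add: block_def)
    then show ?thesis by simp
  qed
  then have "mat_unit 2 3 \<in> ?V + W"
    using compl by (simp add: complementary_in_def)
  then obtain v w where vw: "mat_unit 2 3 = v + w" "v \<in> ?V" "w \<in> W"
    by (rule set_plus_elim)
  have "v $ 2 $ 3 = 0"
    using vw(2) by (auto simp: set_plus_def sym_filt_nth_2_3[OF x_def] bracket_nth_2_3[OF x_def])
  with vw(1) have w23: "w $ 2 $ 3 = 1"
    by (metis add_0 mat_unit_nth vector_add_component)
  have z: "bracket N (bracket N w) =
    (- 2 * w$2$1) *\<^sub>R mat_unit 1 2 + (- 2 * w$4$3) *\<^sub>R mat_unit 3 4 + (- 2 * w$2$3) *\<^sub>R mat_unit 1 4"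
    using vw(3) W(2) by (intro double_bracket_N[OF _ N_def]) auto
  have "N \<in> sym_filt x 0"
    using N_in_sym_comp[OF x_def, of 1] sym_comp_subset_sym_filt[of 0 0 x] by (auto simp: N_def)
  \<comment> \<open>Invariance is applied twice, first to \<open>w\<close> and then to
    \<open>bracket N w\<close>.\<close>
  then have "bracket N (bracket N w) \<in> W"
    using W(3) vw(3) by (simp add: invariant_under_def)
  moreover have "bracket N (bracket N w) \<in> ?V"
    unfolding z by (rule E12_E34_E14_in_sum[OF x_def])
  ultimately have "bracket N (bracket N w) = 0"
    using compl by (auto simp: complementary_in_def)
  \<comment> \<open>By \<open>z\<close> this entry is -2 \<open>w $ 2 $ 3\<close> = -2, the
    contradiction.\<close>
  then have "bracket N (bracket N w) $ 1 $ 4 = 0"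
    by simp
  then show False
    unfolding z by (simp add: mat_unit_nth w23)
qed

end
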